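(* For all integers $n,m\ge 0$, $$\begin{bmatrix} n+m\\ n\end{bmatrix}=\sum_{r\ge 0} p\bigl(n+m+1+r \,\big|\, n+1\text{ parts},\ \text{greatest part}=m+1\bigr)\,q^r .$$ That is, for every $r\ge 0$ the coefficient of $q^r$ in the $q$-binomial coefficient $\begin{bmatrix} n+m\\ n\end{bmatrix}$ equals the number of partitions of $n+m+1+r$ into exactly $n+1$ parts whose greatest part is equal to $m+1$.
   Context: The $q$-binomial coefficient is defined by $$\begin{bmatrix} n\\ k\end{bmatrix}=\frac{(1-q^n)(1-q^{n-1})\cdots(1-q^{n-k+1})}{(1-q)(1-q^2)\cdots(1-q^k)}\quad\text{if }k\le n,\qquad \begin{bmatrix} n\\ k\end{bmatrix}=0\quad\text{if }k>n;$$ it is a polynomial in $q$ (equal to $1$ when $k=0$). A partition of an integer $N$ is a way of writing $N$ as a sum of positive integers (the parts), where the order of addends is not important. The notation $p(N\mid\text{condition})$ denotes the number of partitions of $N$ satisfying the condition. *)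

theory Defs
  imports
    "HOL-Computational_Algebra.Computational_Algebra"
    "HOL-Library.Multiset"
begin

definition qbinomial_num :: "nat \<Rightarrow> nat \<Rightarrow> int poly" where
  "qbinomial_num n k = (\<Prod>i<k. 1 - monom 1 (n - i))"

definition qbinomial_den :: "nat \<Rightarrow> int poly" where
  "qbinomial_den k = (\<Prod>i=1..k. 1 - monom 1 i)"

text \<open>
  The variable \<open>q\<close> is the polynomial variable. The operator \<open>div\<close> is the division of
  the integral domain of integer polynomials; it is exact here, by the lemma
  \<open>qbinomial_quotient\<close> below, so that \<open>qbinomial n k\<close> is the quotient of
  numerator and denominator in the field of rational functions.
\<close>

definition qbinomial :: "nat \<Rightarrow> nat \<Rightarrow> int poly" where
  "qbinomial n k = (if k \<le> n then qbinomial_num n k div qbinomial_den k else 0)"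

lemma qbinomial_den_nonzero: "qbinomial_den k \<noteq> 0"
proof -
  have "(1 - monom 1 i :: int poly) \<noteq> 0" if "i \<in> {1..k}" for i
  proof
    assume "(1 - monom 1 i :: int poly) = 0"
    then have "coeff (1 - monom 1 i :: int poly) 0 = 0" by simp
    with that show False by auto
  qed
  then show ?thesis by (simp add: qbinomial_den_def)
qed

lemma qbinomial_den_dvd_num: "qbinomial_den k dvd qbinomial_num n k"
proof (induction n arbitrary: k)
  case 0
  have "qbinomial_num 0 (Suc j) = 0" for j
    by (auto simp: qbinomial_num_def)
  then show ?case
    by (cases k) (auto simp: qbinomial_num_def qbinomial_den_def)
next
  case (Suc n)
  show ?case
  proof (cases k)
    case 0
    then show ?thesis by (simp add: qbinomial_den_def)
  next
    case (Suc j)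
    have den: "qbinomial_den (Suc j) = qbinomial_den j * (1 - monom 1 (Suc j))"
      by (simp add: qbinomial_den_def)
    have num1: "qbinomial_num (Suc n) (Suc j) = (1 - monom 1 (Suc n)) * qbinomial_num n j"
      unfolding qbinomial_num_def by (subst prod.lessThan_Suc_shift) simp
    have num2: "qbinomial_num n (Suc j) = qbinomial_num n j * (1 - monom 1 (n - j))"
      by (simp add: qbinomial_num_def)
    have "qbinomial_num (Suc n) (Suc j)
            = qbinomial_num n j * (1 - monom 1 (Suc j)) + monom 1 (Suc j) * qbinomial_num n (Suc j)"
    proof (cases "j \<le> n")
      case True
      then have "monom (1::int) (Suc n) = monom 1 (Suc j) * monom 1 (n - j)"
        by (simp add: mult_monom)
      then show ?thesis unfolding num1 num2 by (simp add: algebra_simps)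
    next
      case False
      then have "qbinomial_num n j = 0"
        by (auto simp: qbinomial_num_def intro!: bexI[of _ n])
      then show ?thesis unfolding num1 num2 by simp
    qed
    moreover have "qbinomial_den (Suc j) dvd qbinomial_num n j * (1 - monom 1 (Suc j))"
      unfolding den by (intro mult_dvd_mono Suc.IH dvd_refl)
    moreover have "qbinomial_den (Suc j) dvd monom 1 (Suc j) * qbinomial_num n (Suc j)"
      by (intro dvd_mult Suc.IH)
    ultimately show ?thesis using Suc by (simp add: dvd_add)
  qed
qed

lemma qbinomial_quotient:
  assumes "k \<le> n"
  shows "qbinomial n k * qbinomial_den k = qbinomial_num n k"
  using assms qbinomial_den_dvd_num[of k n] by (simp add: qbinomial_def)

definition partitions :: "nat \<Rightarrow> nat multiset set" where
  "partitions N = {M. 0 \<notin># M \<and> \<Sum>\<^sub># M = N}"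

definition num_partitions :: "nat \<Rightarrow> (nat multiset \<Rightarrow> bool) \<Rightarrow> nat" where
  "num_partitions N P = card {M \<in> partitions N. P M}"

lemma finite_partitions: "finite (partitions N)"
proof -
  have size: "0 \<notin># M \<Longrightarrow> size M \<le> \<Sum>\<^sub># M" for M :: "nat multiset"
    by (induction M) auto
  have elem: "x \<in># M \<Longrightarrow> x \<le> \<Sum>\<^sub># M" for x and M :: "nat multiset"
    by (auto simp: sum_mset.remove)
  have "partitions N \<subseteq> mset ` {xs. set xs \<subseteq> {..N} \<and> length xs \<le> N}"
  proof
    fix M assume M: "M \<in> partitions N"
    obtain xs where "M = mset xs" by (metis ex_mset)
    with M size[of M] elem[of _ M]
    show "M \<in> mset ` {xs. set xs \<subseteq> {..N} \<and> length xs \<le> N}"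
      by (auto simp: partitions_def)
  qed
  then show ?thesis
    by (rule finite_subset) (intro finite_imageI finite_lists_length_le finite_atMost)
qed

end

theory Submission
  imports Defs
begin

text \<open>
  Read a partition as a Young diagram. One with \<open>n + 1\<close> parts and greatest part \<open>m + 1\<close> has a
  first row and a first column of known lengths; together they form a hook of \<open>n + m + 1\<close> cells.
  Deleting this hook leaves an arbitrary diagram inside an \<open>n \<times> m\<close> box, whose empty rows count as
  parts \<open>0\<close>, so the partitions in question are counted by the diagrams with \<open>r\<close> cells in that box
  (\<open>card_hook_partitions\<close>).

  The generating polynomial of the diagrams in a box is the Gaussian binomial coefficient
  (\<open>box_gf_eq_qbinomial\<close>), because both sides satisfy the same recurrence. For the diagrams, one
  distinguishes whether the full width of the box is attained (\<open>box_Suc_Suc\<close>); for the Gaussian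
  coefficients it is a \<open>q\<close>-analogue of the rule of Pascal (\<open>qbinomial_pascal\<close>).
\<close>

section \<open>Gaussian binomial coefficients\<close>

lemma qbinomial_0 [simp]: "qbinomial n 0 = 1"
  by (simp add: qbinomial_def qbinomial_num_def qbinomial_den_def)

lemma qbinomial_self [simp]: "qbinomial n n = 1"
proof -
  have "qbinomial_num n n = qbinomial_den n"
    unfolding qbinomial_num_def qbinomial_den_def
    by (rule prod.reindex_bij_witness[of _ "\<lambda>i. n - i" "\<lambda>i. n - i"]) auto
  then show ?thesis
    by (simp add: qbinomial_def qbinomial_den_nonzero)
qed

text \<open>
  Over the common denominator \<open>(1 - q) \<dots> (1 - q^(n + 1))\<close> the rule reduces to
  \<open>1 - q^(n + m + 2) = (1 - q^(m + 1)) + q^(m + 1) (1 - q^(n + 1))\<close>.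
  The power of \<open>q\<close> stands with the lower index \<open>n\<close>, in accordance with \<open>box_Suc_Suc\<close>, where
  removing a part \<open>m + 1\<close> lowers the number of parts.
\<close>

lemma qbinomial_pascal:
  "qbinomial (Suc n + Suc m) (Suc n)
     = qbinomial (Suc n + m) (Suc n) + monom 1 (Suc m) * qbinomial (n + Suc m) n"
proof -
  let ?N = "Suc (n + m)" and ?D = "qbinomial_den (Suc n)"
  have den: "?D = qbinomial_den n * (1 - monom 1 (Suc n))"
    by (simp add: qbinomial_den_def)
  have num_shift: "qbinomial_num (Suc ?N) (Suc n) = (1 - monom 1 (Suc ?N)) * qbinomial_num ?N n"
    unfolding qbinomial_num_def by (subst prod.lessThan_Suc_shift) simp
  have num_last: "qbinomial_num ?N (Suc n) = qbinomial_num ?N n * (1 - monom 1 (Suc m))"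
    by (simp add: qbinomial_num_def)
  have monom_split: "monom (1::int) (Suc ?N) = monom 1 (Suc m) * monom 1 (Suc n)"
    by (simp add: mult_monom add.commute)
  have "qbinomial (Suc ?N) (Suc n) * ?D = qbinomial_num (Suc ?N) (Suc n)"
    by (rule qbinomial_quotient) simp
  also have "\<dots> = qbinomial_num ?N (Suc n)
      + monom 1 (Suc m) * (qbinomial_num ?N n * (1 - monom 1 (Suc n)))"
    unfolding num_shift num_last monom_split by (simp add: algebra_simps)
  also have "\<dots> = qbinomial ?N (Suc n) * ?D
      + monom 1 (Suc m) * (qbinomial ?N n * qbinomial_den n * (1 - monom 1 (Suc n)))"
    by (simp add: qbinomial_quotient)
  also have "\<dots> = (qbinomial ?N (Suc n) + monom 1 (Suc m) * qbinomial ?N n) * ?D"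
    unfolding den by (simp only: algebra_simps)
  finally show ?thesis
    using qbinomial_den_nonzero[of "Suc n"] by simp
qed

section \<open>Partitions inside a box\<close>

text \<open>
  Parts \<open>0\<close> are admitted, so that having at most \<open>n\<close> positive parts is the same as having
  exactly \<open>n\<close> entries.
\<close>

definition box :: "nat \<Rightarrow> nat \<Rightarrow> nat multiset set" where
  "box n m = {M. size M = n \<and> set_mset M \<subseteq> {..m}}"

lemma box_0_left: "box 0 m = {{#}}"
  by (auto simp: box_def)

lemma box_0_right: "box n 0 = {replicate_mset n 0}"
  by (auto simp: box_def intro: set_mset_subset_singletonD split: if_splits)

lemma box_Suc_Suc: "box (Suc n) (Suc m) = box (Suc n) m \<union> add_mset (Suc m) ` box n (Suc m)"
proof (intro subset_antisym subsetI)
  fix M assume M: "M \<in> box (Suc n) (Suc m)"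
  show "M \<in> box (Suc n) m \<union> add_mset (Suc m) ` box n (Suc m)"
  proof (cases "Suc m \<in># M")
    case True
    then obtain M' where "M = add_mset (Suc m) M'"
      by (metis insert_DiffM)
    with M show ?thesis by (auto simp: box_def)
  next
    case False
    have "x \<le> m" if "x \<in># M" for x
    proof -
      have "x \<le> Suc m" "x \<noteq> Suc m" using M False that by (auto simp: box_def)
      then show ?thesis by simp
    qed
    with M show ?thesis by (auto simp: box_def)
  qed
qed (auto simp: box_def)

lemma box_disjoint: "box (Suc n) m \<inter> add_mset (Suc m) ` box n (Suc m) = {}"
  by (auto simp: box_def)

lemma finite_box: "finite (box n m)"
proof (induction "n + m" arbitrary: n m rule: less_induct)
  case less
  then show ?case
    by (cases n; cases m) (simp_all add: box_0_left box_0_right box_Suc_Suc)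
qed

definition box_gf :: "nat \<Rightarrow> nat \<Rightarrow> int poly" where
  "box_gf n m = (\<Sum>M\<in>box n m. monom 1 (\<Sum>\<^sub># M))"

lemma coeff_box_gf: "coeff (box_gf n m) r = int (card {M \<in> box n m. \<Sum>\<^sub># M = r})"
  by (simp add: box_gf_def coeff_sum finite_box sum.If_cases Int_def flip: sum.inter_filter)

lemma box_gf_Suc_Suc:
  "box_gf (Suc n) (Suc m) = box_gf (Suc n) m + monom 1 (Suc m) * box_gf n (Suc m)"
proof -
  have "(\<Sum>M\<in>add_mset (Suc m) ` box n (Suc m). monom (1::int) (\<Sum>\<^sub># M))
      = (\<Sum>M\<in>box n (Suc m). monom 1 (Suc m + \<Sum>\<^sub># M))"
    by (subst sum.reindex) (auto simp: inj_on_def)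
  also have "\<dots> = monom 1 (Suc m) * box_gf n (Suc m)"
    by (simp add: box_gf_def sum_distrib_left mult_monom)
  finally show ?thesis
    by (simp add: box_gf_def box_Suc_Suc sum.union_disjoint finite_box box_disjoint)
qed

lemma box_gf_eq_qbinomial: "box_gf n m = qbinomial (n + m) n"
proof (induction "n + m" arbitrary: n m rule: less_induct)
  case less
  show ?case
  proof (cases n)
    case 0
    then show ?thesis by (simp add: box_gf_def box_0_left)
  next
    case n: (Suc n')
    show ?thesis
    proof (cases m)
      case 0
      then show ?thesis by (simp add: box_gf_def box_0_right)
    next
      case m: (Suc m')
      have "box_gf (Suc n') m' = qbinomial (Suc n' + m') (Suc n')"
        "box_gf n' (Suc m') = qbinomial (n' + Suc m') n'"
        by (rule less; simp add: n m)+
      then show ?thesis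
        unfolding n m qbinomial_pascal box_gf_Suc_Suc by simp
    qed
  qed
qed

section \<open>Deleting the hook\<close>

lemma sum_mset_image_Suc: "\<Sum>\<^sub># (image_mset Suc M) = size M + \<Sum>\<^sub># M"
  by (induction M) auto

text \<open>
  The map \<open>M \<mapsto> add_mset (m + 1) (image_mset Suc M)\<close> attaches the hook: the first column by raising
  every entry, the first row as a new greatest part. Entries \<open>0\<close> turn into parts \<open>1\<close>, so that \<open>n\<close> entries always yield
  \<open>n + 1\<close> positive parts.
\<close>

lemma card_hook_partitions:
  "num_partitions (n + m + 1 + r) (\<lambda>M. size M = n + 1 \<and> Max (set_mset M) = m + 1)
     = card {M \<in> box n m. \<Sum>\<^sub># M = r}"
proof -
  let ?hook = "\<lambda>M. add_mset (Suc m) (image_mset Suc M)"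
  let ?P = "{M \<in> partitions (n + m + 1 + r). size M = n + 1 \<and> Max (set_mset M) = m + 1}"
  let ?B = "{M \<in> box n m. \<Sum>\<^sub># M = r}"
  have image: "?hook ` ?B = ?P"
  proof (intro subset_antisym subsetI)
    fix M assume "M \<in> ?hook ` ?B"
    then obtain L where L: "L \<in> ?B" "M = ?hook L" by blast
    then have "Max (set_mset M) = m + 1"
      by (intro Max_eqI) (auto simp: box_def)
    with L show "M \<in> ?P"
      by (auto simp: box_def partitions_def sum_mset_image_Suc)
  next
    fix M assume M: "M \<in> ?P"
    then have ne: "set_mset M \<noteq> {}" and Max: "Max (set_mset M) = Suc m" by auto
    have le: "x \<le> Suc m" if "x \<in># M" for x
      using Max_ge[OF finite_set_mset that] by (simp only: Max)
    have "Suc m \<in># M"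
      using Max_in[OF finite_set_mset ne] by (simp only: Max)
    then obtain L where L: "M = add_mset (Suc m) L"
      by (metis insert_DiffM)
    let ?K = "image_mset (\<lambda>x. x - 1) L"
    have pos: "0 \<notin># L"
      using M L by (auto simp: partitions_def)
    have K: "image_mset Suc ?K = L"
      using pos by (induction L) auto
    have "size ?K = n"
      using M L by simp
    moreover have "\<Sum>\<^sub># ?K = r"
      using M L sum_mset_image_Suc[of ?K] unfolding K by (simp add: partitions_def)
    moreover have "set_mset ?K \<subseteq> {..m}"
      using le L by force
    ultimately show "M \<in> ?hook ` ?B"
      using L K by (intro image_eqI[of _ _ ?K]) (auto simp: box_def)
  qed
  have inj: "inj_on ?hook ?B"
  proof (rule inj_onI)
    fix K L assume "?hook K = ?hook L"
    then have "image_mset Suc K = image_mset Suc L" by simp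
    then show "K = L" by (rule injD[OF multiset.inj_map[OF inj_Suc]])
  qed
  show ?thesis
    unfolding num_partitions_def image[symmetric] by (rule card_image[OF inj])
qed

theorem mainTheorem2:
  fixes n m r :: nat
  shows "coeff (qbinomial (n + m) n) r =
    int (num_partitions (n + m + 1 + r)
      (\<lambda>M. size M = n + 1 \<and> Max (set_mset M) = m + 1))"
  unfolding card_hook_partitions box_gf_eq_qbinomial[symmetric] by (rule coeff_box_gf)

end
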